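(* Let $n\geq 1$ and $l\geq 1$ be integers, let $p=2$ and $d=2^l$. Then the extension of $\mathrm{GL}_n(\mathbb{Z})$-modules $$0\to S^d(n)\to E_d(n)\to I(n)\to 0,$$ obtained by evaluating at $\mathbb{Z}^n$ the extension of functors $0\to S^d\to E_d\to I\to 0$ (usual inclusion and projection for $E_d(s)=S^d(s)\oplus I(s)$), does not split.
   Context: $\mathsf{ab}$ is the category of finitely generated free abelian groups and homomorphisms, with objects (up to isomorphism) labelled by $n\in\mathbb{N}=\{0,1,2,\dots\}$, $n$ standing for $\mathbb{Z}^n$ with canonical basis $e_1,\dots,e_n$. $\mathsf{Ab}$ is the category of abelian groups, $I:\mathsf{ab}\to\mathsf{Ab}$ is the inclusion, and $S^d:\mathsf{ab}\to\mathsf{Ab}$ is the $d$-th symmetric power. For a functor $F:\mathsf{ab}\to\mathsf{Ab}$, $F(n)$ is a $\mathrm{GL}_n(\mathbb{Z})$-module via $\mathrm{GL}_n(\mathbb{Z})\subset\mathsf{ab}(n,n)$. Consider the following morphisms of $\mathsf{ab}$: $\epsilon:1\to 0$ and $\eta:0\to 1$ (zero maps), $\Delta:1\to 2$ the diagonal, $\nabla:2\to 1$, $(x,y)\mapsto x+y$, $S:1\to 1$, $x\mapsto -x$, $\tau:2\to 2$ exchanging the two generators. For $f$ one of these and $n,m\in\mathbb{N}$ put ${}_n[f]_m=\mathrm{id}_n\oplus f\oplus\mathrm{id}_m$. These morphisms generate $\mathsf{ab}$ under composition (Pirashvili). For $d=p^l$ with $p$ prime and $l\ge1$, $E_d:\mathsf{ab}\to\mathsf{Ab}$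 is the (unique) functor with $E_d(s)=S^d(s)\oplus I(s)$ for $s\in\mathbb{N}$ and, for each generating morphism $g={}_n[f]_m:s\to t$, $$E_d(g)=\begin{pmatrix}S^d(g)&D_d(g)\\0&I(g)\end{pmatrix},$$ where $D_d(g):I(s)\to S^d(t)$ is the homomorphism given as follows: $D_d({}_n[S]_m)$ sends $e_{n+1}$ to $\frac{1+(-1)^d}{p}e_{n+1}^d$ and every other $e_i$ to $0$; $D_d({}_n[\Delta]_m)$ sends $e_{n+1}$ to $\sum_{k=1}^{d-1}\frac1p\binom{p^l}{k}e_{n+1}^ke_{n+2}^{d-k}$ and every other $e_i$ to $0$; and $D_d(g)=0$ for all other generating morphisms. *)

theory Defs
  imports
    "Jordan_Normal_Form.Matrix"
    "HOL-Algebra.Free_Abelian_Groups"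
begin

text \<open>
  Abelian groups are \<open>comm_group\<close> structures, written multiplicatively as in HOL-Algebra: a sum in
  the mathematics is a product \<open>\<otimes>\<close> or \<open>finprod\<close> here, and an integer multiple is a power \<open>[^]\<close>.

  The category ab is represented by its skeleton: the object \<open>n\<close> is \<open>\<int>\<^sup>n\<close>, and a morphism from
  \<open>s\<close> to \<open>t\<close> is an integer matrix with \<open>t\<close> rows and \<open>s\<close> columns acting on column vectors.
  Indices start at 0, so the mathematical basis vector \<open>e\<close> with index \<open>i + 1\<close> is \<open>unit_vec _ i\<close>.
\<close>

section \<open>Functors from ab to Ab\<close>

text \<open>The morphism part takes the matrix alone, since a matrix determines its source and target.
  Functions on groups only matter on carriers.\<close>

definition ab_functor :: "(nat \<Rightarrow> 'a monoid) \<Rightarrow> (int mat \<Rightarrow> 'a \<Rightarrow> 'a) \<Rightarrow> bool" where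
  "ab_functor Fo Fm \<longleftrightarrow>
     (\<forall>s. comm_group (Fo s)) \<and>
     (\<forall>s t. \<forall>A \<in> carrier_mat t s. Fm A \<in> hom (Fo s) (Fo t)) \<and>
     (\<forall>s. \<forall>x \<in> carrier (Fo s). Fm (1\<^sub>m s) x = x) \<and>
     (\<forall>s t u. \<forall>A \<in> carrier_mat u t. \<forall>B \<in> carrier_mat t s. \<forall>x \<in> carrier (Fo s).
        Fm (A * B) x = Fm A (Fm B x))"

definition I_obj :: "nat \<Rightarrow> int vec monoid" where
  "I_obj n = monoid_vec TYPE(int) n"

definition I_mor :: "int mat \<Rightarrow> int vec \<Rightarrow> int vec" where
  "I_mor A v = A *\<^sub>v v"


section \<open>Symmetric powers\<close>

text \<open>The symmetric power of an abelian group \<open>G\<close> is the free abelian group on \<open>d\<close>-tuples of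
  elements of \<open>G\<close>, modulo additivity in every position and invariance under permutations.\<close>

definition tuples :: "nat \<Rightarrow> 'a monoid \<Rightarrow> 'a list set" where
  "tuples d G = {xs. length xs = d \<and> set xs \<subseteq> carrier G}"

definition sym_relators :: "nat \<Rightarrow> 'a monoid \<Rightarrow> ('a list \<Rightarrow>\<^sub>0 int) set" where
  "sym_relators d G =
     {frag_of (xs @ (x \<otimes>\<^bsub>G\<^esub> y) # ys) - frag_of (xs @ x # ys) - frag_of (xs @ y # ys) | xs x y ys.
        xs @ x # ys \<in> tuples d G \<and> y \<in> carrier G} \<union>
     {frag_of xs - frag_of ys | xs ys. xs \<in> tuples d G \<and> mset ys = mset xs}"

definition sym_kernel :: "nat \<Rightarrow> 'a monoid \<Rightarrow> ('a list \<Rightarrow>\<^sub>0 int) set" where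
  "sym_kernel d G = generate (free_Abelian_group (tuples d G)) (sym_relators d G)"

definition sym_power :: "nat \<Rightarrow> 'a monoid \<Rightarrow> ('a list \<Rightarrow>\<^sub>0 int) set monoid" where
  "sym_power d G = free_Abelian_group (tuples d G) Mod sym_kernel d G"

definition sym_class :: "nat \<Rightarrow> 'a monoid \<Rightarrow> ('a list \<Rightarrow>\<^sub>0 int) \<Rightarrow> ('a list \<Rightarrow>\<^sub>0 int) set" where
  "sym_class d G c = sym_kernel d G #>\<^bsub>free_Abelian_group (tuples d G)\<^esub> c"

text \<open>The symmetric product of the entries of a \<open>d\<close>-tuple.\<close>

definition sym_prod :: "'a monoid \<Rightarrow> 'a list \<Rightarrow> ('a list \<Rightarrow>\<^sub>0 int) set" where
  "sym_prod G xs = sym_class (length xs) G (frag_of xs)"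

text \<open>For a homomorphism \<open>f\<close> into \<open>H\<close>, the induced map sends the class of a tuple \<open>xs\<close> to the class
  of \<open>map f xs\<close>; all members of the union below are then the same coset.\<close>

definition sym_map :: "nat \<Rightarrow> 'b monoid \<Rightarrow> ('a \<Rightarrow> 'b) \<Rightarrow>
    ('a list \<Rightarrow>\<^sub>0 int) set \<Rightarrow> ('b list \<Rightarrow>\<^sub>0 int) set" where
  "sym_map d H f C = (\<Union>c\<in>C. sym_class d H (frag_extend (\<lambda>xs. frag_of (map f xs)) c))"

definition S_obj :: "nat \<Rightarrow> nat \<Rightarrow> (int vec list \<Rightarrow>\<^sub>0 int) set monoid" where
  "S_obj d n = sym_power d (I_obj n)"

definition S_mor :: "nat \<Rightarrow> int mat \<Rightarrow>
    (int vec list \<Rightarrow>\<^sub>0 int) set \<Rightarrow> (int vec list \<Rightarrow>\<^sub>0 int) set" where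
  "S_mor d A = sym_map d (I_obj (dim_row A)) (I_mor A)"


section \<open>Generating morphisms\<close>

datatype gen = Counit | Unit | Diagonal | Codiagonal | Antipode | Swap

fun gen_mat :: "gen \<Rightarrow> int mat" where
  "gen_mat Counit = 0\<^sub>m 0 1"
| "gen_mat Unit = 0\<^sub>m 1 0"
| "gen_mat Diagonal = mat 2 1 (\<lambda>_. 1)"
| "gen_mat Codiagonal = mat 1 2 (\<lambda>_. 1)"
| "gen_mat Antipode = mat 1 1 (\<lambda>_. - 1)"
| "gen_mat Swap = mat 2 2 (\<lambda>(i, j). if i = j then 0 else 1)"

definition whisker :: "nat \<Rightarrow> gen \<Rightarrow> nat \<Rightarrow> int mat" where
  "whisker n f m = diag_block_mat [1\<^sub>m n, gen_mat f, 1\<^sub>m m]"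


section \<open>The functors \<open>E\<^sub>d\<close>\<close>

text \<open>The value of \<open>D\<^sub>d\<close> on the basis vector at position \<open>n\<close>, for \<open>d = p ^ l\<close>. For prime \<open>p\<close> and
  positive \<open>l\<close> both uses of \<open>div\<close> are exact.\<close>

fun D_value :: "nat \<Rightarrow> nat \<Rightarrow> nat \<Rightarrow> gen \<Rightarrow> nat \<Rightarrow> (int vec list \<Rightarrow>\<^sub>0 int) set" where
  "D_value p l n Antipode m =
     (let d = p ^ l; t = n + 1 + m in
      sym_prod (I_obj t) (replicate d (unit_vec t n))
        [^]\<^bsub>S_obj d t\<^esub> ((1 + (- 1) ^ d) div int p))"
| "D_value p l n Diagonal m =
     (let d = p ^ l; t = n + 2 + m in
      finprod (S_obj d t)
        (\<lambda>k. sym_prod (I_obj t)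
               (replicate k (unit_vec t n) @ replicate (d - k) (unit_vec t (n + 1)))
             [^]\<^bsub>S_obj d t\<^esub> (int (d choose k) div int p))
        {1..d - 1})"
| "D_value p l n f m = \<one>\<^bsub>S_obj (p ^ l) (dim_row (whisker n f m))\<^esub>"

text \<open>\<open>D\<^sub>d\<close> itself is the homomorphism that takes this value at position \<open>n\<close> and vanishes on all
  other basis vectors.\<close>

definition D_map :: "nat \<Rightarrow> nat \<Rightarrow> nat \<Rightarrow> gen \<Rightarrow> nat \<Rightarrow> int vec \<Rightarrow> (int vec list \<Rightarrow>\<^sub>0 int) set" where
  "D_map p l n f m v =
     (let T = S_obj (p ^ l) (dim_row (whisker n f m)) in
      finprod T (\<lambda>i. (if i = n then D_value p l n f m else \<one>\<^bsub>T\<^esub>) [^]\<^bsub>T\<^esub> (v $ i))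
        {..<dim_col (whisker n f m)})"

definition E_obj :: "nat \<Rightarrow> nat \<Rightarrow> ((int vec list \<Rightarrow>\<^sub>0 int) set \<times> int vec) monoid" where
  "E_obj d s = S_obj d s \<times>\<times> I_obj s"

text \<open>\<open>is_E p l E\<close> says that \<open>E\<close> is the morphism part of the functor \<open>E\<^sub>d\<close> with \<open>d = p ^ l\<close>: it is a
  functor on the objects \<open>E_obj\<close> with the prescribed block triangular values on generators.\<close>

definition is_E :: "nat \<Rightarrow> nat \<Rightarrow>
    (int mat \<Rightarrow> (int vec list \<Rightarrow>\<^sub>0 int) set \<times> int vec \<Rightarrow> (int vec list \<Rightarrow>\<^sub>0 int) set \<times> int vec) \<Rightarrow> bool"
  where
  "is_E p l E \<longleftrightarrow>
     ab_functor (E_obj (p ^ l)) E \<and>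
     (\<forall>n f m. let g = whisker n f m in
        \<forall>x \<in> carrier (S_obj (p ^ l) (dim_col g)). \<forall>v \<in> carrier (I_obj (dim_col g)).
          E g (x, v) =
            (S_mor (p ^ l) g x \<otimes>\<^bsub>S_obj (p ^ l) (dim_row g)\<^esub> D_map p l n f m v, I_mor g v))"


section \<open>Extensions of \<open>GL\<^sub>n(\<int>)\<close>-modules\<close>

definition GL :: "nat \<Rightarrow> int mat set" where
  "GL n = Units (ring_mat TYPE(int) n ())"

text \<open>A \<open>GL\<^sub>n(\<int>)\<close>-module is given by an abelian group together with its action map.\<close>

definition GL_hom :: "nat \<Rightarrow> 'a monoid \<Rightarrow> (int mat \<Rightarrow> 'a \<Rightarrow> 'a) \<Rightarrow>
    'b monoid \<Rightarrow> (int mat \<Rightarrow> 'b \<Rightarrow> 'b) \<Rightarrow> ('a \<Rightarrow> 'b) set" where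
  "GL_hom n M \<alpha> N \<beta> = {f \<in> hom M N. \<forall>A \<in> GL n. \<forall>x \<in> carrier M. f (\<alpha> A x) = \<beta> A (f x)}"

text \<open>An extension of the module \<open>Q\<close>, with projection \<open>\<pi>\<close> from the middle module \<open>M\<close> onto \<open>Q\<close>, splits
  if \<open>\<pi>\<close> has a section that is a module homomorphism.\<close>

definition GL_extension_splits :: "nat \<Rightarrow> 'a monoid \<Rightarrow> (int mat \<Rightarrow> 'a \<Rightarrow> 'a) \<Rightarrow> ('a \<Rightarrow> 'b) \<Rightarrow>
    'b monoid \<Rightarrow> (int mat \<Rightarrow> 'b \<Rightarrow> 'b) \<Rightarrow> bool" where
  "GL_extension_splits n M \<alpha> \<pi> Q \<beta> \<longleftrightarrow>
     (\<exists>\<sigma> \<in> GL_hom n Q \<beta> M \<alpha>. \<forall>x \<in> carrier Q. \<pi> (\<sigma> x) = x)"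

end

theory Submission
  imports Defs
begin

text \<open>
  Let \<open>A\<close> be the diagonal matrix with entries \<open>-1, 1, \<dots>, 1\<close>, and let \<open>\<phi>\<close> be the homomorphism from
  the symmetric power to the integers that multiplies the first coordinates of the factors. As
  \<open>d\<close> is even, \<open>\<phi>\<close> is invariant under \<open>A\<close>. If an equivariant section sends the first basis vector
  \<open>e\<close> to \<open>(x, e)\<close>, then applying it to \<open>A e = - e\<close> yields \<open>A x + e ^ d = - x\<close>, because \<open>D\<^sub>d(A)\<close>
  takes \<open>e\<close> to \<open>e ^ d\<close>. Under \<open>\<phi>\<close> this becomes \<open>2 \<phi>(x) = - 1\<close>.
\<close>

section \<open>Universal property of symmetric powers\<close>

lemma sym_relators_subset_carrier:
  assumes "group G"
  shows "sym_relators d G \<subseteq> carrier (free_Abelian_group (tuples d G))"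
proof
  interpret group G by fact
  fix c assume "c \<in> sym_relators d G"
  then consider
      xs x y ys where "xs @ x # ys \<in> tuples d G" "y \<in> carrier G"
        "c = frag_of (xs @ (x \<otimes>\<^bsub>G\<^esub> y) # ys) - frag_of (xs @ x # ys) - frag_of (xs @ y # ys)"
    | xs ys where "xs \<in> tuples d G" "mset ys = mset xs" "c = frag_of xs - frag_of ys"
    unfolding sym_relators_def by blast
  then show "c \<in> carrier (free_Abelian_group (tuples d G))"
  proof cases
    case 1
    then have "xs @ (x \<otimes>\<^bsub>G\<^esub> y) # ys \<in> tuples d G" "xs @ y # ys \<in> tuples d G"
      by (auto simp: tuples_def)
    then have "frag_of (xs @ (x \<otimes>\<^bsub>G\<^esub> y) # ys) - frag_of (xs @ x # ys)
        \<in> carrier (free_Abelian_group (tuples d G))"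
      using 1(1) keys_diff[of "frag_of (xs @ (x \<otimes>\<^bsub>G\<^esub> y) # ys)" "frag_of (xs @ x # ys)"] by auto
    with \<open>xs @ y # ys \<in> tuples d G\<close> show ?thesis
      unfolding 1(3) carrier_free_Abelian_group_iff
      by (intro order.trans[OF keys_diff]) auto
  next
    case 2
    then have "ys \<in> tuples d G"
      using mset_eq_setD[OF 2(2)] mset_eq_length[OF 2(2)] by (auto simp: tuples_def)
    then show ?thesis
      using 2 keys_diff[of "frag_of xs" "frag_of ys"] by auto
  qed
qed

lemma sym_kernel_normal:
  assumes "group G"
  shows "sym_kernel d G \<lhd> free_Abelian_group (tuples d G)"
  unfolding sym_kernel_def
  by (intro comm_group.subgroup_imp_normal abelian_free_Abelian_group
      group.generate_is_subgroup group_free_Abelian_group sym_relators_subset_carrier assms)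

lemma sym_power_comm_group:
  assumes "group G"
  shows "comm_group (sym_power d G)"
  unfolding sym_power_def
  by (intro comm_group.abelian_FactGroup abelian_free_Abelian_group
      normal_imp_subgroup sym_kernel_normal assms)

lemma sym_power_cases:
  assumes "X \<in> carrier (sym_power d G)"
  obtains c where "Poly_Mapping.keys c \<subseteq> tuples d G" "X = sym_class d G c"
  using assms by (auto simp: sym_power_def sym_class_def carrier_FactGroup)

lemma sym_class_closed:
  "Poly_Mapping.keys c \<subseteq> tuples d G \<Longrightarrow> sym_class d G c \<in> carrier (sym_power d G)"
  by (auto simp: sym_power_def sym_class_def carrier_FactGroup)

lemma sym_class_hom:
  assumes "group G"
  shows "sym_class d G \<in> hom (free_Abelian_group (tuples d G)) (sym_power d G)"
proof (rule homI)
  interpret normal "sym_kernel d G" "free_Abelian_group (tuples d G)"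
    using assms by (rule sym_kernel_normal)
  fix c c' assume "c \<in> carrier (free_Abelian_group (tuples d G))"
    "c' \<in> carrier (free_Abelian_group (tuples d G))"
  then show "sym_class d G (c \<otimes>\<^bsub>free_Abelian_group (tuples d G)\<^esub> c') =
      sym_class d G c \<otimes>\<^bsub>sym_power d G\<^esub> sym_class d G c'"
    unfolding sym_class_def sym_power_def mult_FactGroup by (rule rcos_sum[symmetric])
qed (simp add: sym_class_closed)

lemma sym_prod_closed:
  assumes "xs \<in> tuples d G"
  shows "sym_prod G xs \<in> carrier (sym_power d G)"
proof -
  have "length xs = d" using assms by (simp add: tuples_def)
  then show ?thesis using assms by (auto simp: sym_prod_def intro!: sym_class_closed)
qed

section \<open>Homomorphisms determined on generators\<close>

lemma hom_diff_free_Abelian_group: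
  assumes "group H" "h \<in> hom (free_Abelian_group S) H"
    and "Poly_Mapping.keys a \<subseteq> S" "Poly_Mapping.keys b \<subseteq> S"
  shows "h (a - b) = h a \<otimes>\<^bsub>H\<^esub> inv\<^bsub>H\<^esub> h b"
proof -
  interpret group_hom "free_Abelian_group S" H h
    using assms by (simp add: group_hom_def group_hom_axioms_def)
  \<comment> \<open>The simplifier would normally turn the operations of the free abelian group into
    \<open>+\<close> and \<open>-\<close>. They are kept in group form here so that the rules for
    homomorphisms and inverses apply.\<close>
  have "h (a \<otimes>\<^bsub>free_Abelian_group S\<^esub> inv\<^bsub>free_Abelian_group S\<^esub> b) = h a \<otimes>\<^bsub>H\<^esub> inv\<^bsub>H\<^esub> h b"
    using assms(3,4)
    by (simp del: mult_free_Abelian_group inv_free_Abelian_group carrier_free_Abelian_group_iff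
        add: carrier_free_Abelian_group_iff[symmetric])
  then show ?thesis using assms by simp
qed

text \<open>Zero, the basis elements and closure under differences exhaust a free abelian group, and
  homomorphisms respect differences.\<close>

lemma hom_eq_on_free_Abelian_group:
  assumes "group H" "h \<in> hom (free_Abelian_group S) H" "k \<in> hom (free_Abelian_group S) H"
    and "\<And>x. x \<in> S \<Longrightarrow> h (frag_of x) = k (frag_of x)" "Poly_Mapping.keys c \<subseteq> S"
  shows "h c = k c"
  using assms(5)
proof (rule free_Abelian_group_induct)
  show "h 0 = k 0"
    using hom_one[OF assms(2)] hom_one[OF assms(3)] assms(1) by simp
next
  fix a b assume "Poly_Mapping.keys a \<subseteq> S" "Poly_Mapping.keys b \<subseteq> S" "h a = k a" "h b = k b"
  then show "h (a - b) = k (a - b)"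
    by (simp add: hom_diff_free_Abelian_group[OF assms(1,2)]
        hom_diff_free_Abelian_group[OF assms(1,3)])
qed (rule assms(4))

text \<open>Composing with the quotient map \<open>sym_class d G\<close> moves the comparison to the
  free abelian group, whose basis elements have the symmetric products as classes.\<close>

lemma sym_power_hom_eqI:
  assumes "group G" "group H" "\<phi> \<in> hom (sym_power d G) H" "\<psi> \<in> hom (sym_power d G) H"
    and "\<And>xs. xs \<in> tuples d G \<Longrightarrow> \<phi> (sym_prod G xs) = \<psi> (sym_prod G xs)"
    and "X \<in> carrier (sym_power d G)"
  shows "\<phi> X = \<psi> X"
proof -
  obtain c where c: "Poly_Mapping.keys c \<subseteq> tuples d G" "X = sym_class d G c"
    using assms(6) by (rule sym_power_cases)
  have "(\<phi> \<circ> sym_class d G) c = (\<psi> \<circ> sym_class d G) c"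
  proof (rule hom_eq_on_free_Abelian_group[OF assms(2) _ _ _ c(1)])
    fix xs assume xs: "xs \<in> tuples d G"
    then have "length xs = d" by (simp add: tuples_def)
    then show "(\<phi> \<circ> sym_class d G) (frag_of xs) = (\<psi> \<circ> sym_class d G) (frag_of xs)"
      using assms(5)[OF xs] by (simp add: sym_prod_def)
  qed (rule hom_compose[OF sym_class_hom[OF assms(1)]], rule assms(3,4))+
  then show ?thesis by (simp add: c(2))
qed

section \<open>The defining relations and the universal property\<close>

lemma sym_class_eqI:
  assumes "group G" "a - b \<in> sym_relators d G"
    and "Poly_Mapping.keys a \<subseteq> tuples d G" "Poly_Mapping.keys b \<subseteq> tuples d G"
  shows "sym_class d G a = sym_class d G b"
proof -
  interpret K: normal "sym_kernel d G" "free_Abelian_group (tuples d G)"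
    using assms(1) by (rule sym_kernel_normal)
  have "a - b \<in> sym_kernel d G"
    unfolding sym_kernel_def using assms(2) by (rule generate.incl)
  then have "a \<in> sym_class d G b"
    unfolding sym_class_def r_coset_def by (auto intro!: bexI[of _ "a - b"])
  then show ?thesis
    unfolding sym_class_def using K.repr_independence[OF _ _ K.subgroup_axioms] assms(4) by simp
qed

lemma sym_class_add:
  assumes "group G" "xs @ x # ys \<in> tuples d G" "y \<in> carrier G"
  shows "sym_class d G (frag_of (xs @ (x \<otimes>\<^bsub>G\<^esub> y) # ys)) =
    sym_class d G (frag_of (xs @ x # ys)) \<otimes>\<^bsub>sym_power d G\<^esub> sym_class d G (frag_of (xs @ y # ys))"
proof -
  interpret group G by fact
  have t: "xs @ (x \<otimes>\<^bsub>G\<^esub> y) # ys \<in> tuples d G" "xs @ y # ys \<in> tuples d G"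
    using assms by (auto simp: tuples_def)
  have "frag_of (xs @ (x \<otimes>\<^bsub>G\<^esub> y) # ys) - frag_of (xs @ x # ys) - frag_of (xs @ y # ys)
      \<in> sym_relators d G"
    unfolding sym_relators_def using assms(2,3) by blast
  then have "sym_class d G (frag_of (xs @ (x \<otimes>\<^bsub>G\<^esub> y) # ys)) =
      sym_class d G (frag_of (xs @ x # ys) + frag_of (xs @ y # ys))"
    using t assms(2)
    by (intro sym_class_eqI[OF assms(1)]) (auto simp: diff_diff_eq intro!: order.trans[OF keys_add])
  also have "\<dots> = sym_class d G (frag_of (xs @ x # ys)) \<otimes>\<^bsub>sym_power d G\<^esub>
      sym_class d G (frag_of (xs @ y # ys))"
    using hom_mult[OF sym_class_hom[OF assms(1)], of "frag_of (xs @ x # ys)" d "frag_of (xs @ y # ys)"]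
      assms(2) t by simp
  finally show ?thesis .
qed

lemma sym_class_perm:
  assumes "group G" "xs \<in> tuples d G" "mset ys = mset xs"
  shows "sym_class d G (frag_of xs) = sym_class d G (frag_of ys)"
proof (rule sym_class_eqI[OF assms(1)])
  show "frag_of xs - frag_of ys \<in> sym_relators d G"
    unfolding sym_relators_def using assms(2,3) by blast
  have "ys \<in> tuples d G"
    using mset_eq_setD[OF assms(3)] mset_eq_length[OF assms(3)] assms(2) by (auto simp: tuples_def)
  then show "Poly_Mapping.keys (frag_of ys) \<subseteq> tuples d G" by simp
qed (simp add: assms(2))

text \<open>A kernel is a subgroup, so it contains everything generated by the relators as soon as
  it contains the relators. This serves twice: for the universal property and for the
  well-definedness of \<open>sym_map\<close>.\<close>

lemma sym_kernel_subset_kernel: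
  assumes "group G" "comm_group H" "h \<in> hom (free_Abelian_group (tuples d G)) H"
    and add: "\<And>xs x y ys. xs @ x # ys \<in> tuples d G \<Longrightarrow> y \<in> carrier G \<Longrightarrow>
      h (frag_of (xs @ (x \<otimes>\<^bsub>G\<^esub> y) # ys)) =
        h (frag_of (xs @ x # ys)) \<otimes>\<^bsub>H\<^esub> h (frag_of (xs @ y # ys))"
    and perm: "\<And>xs ys. xs \<in> tuples d G \<Longrightarrow> mset ys = mset xs \<Longrightarrow> h (frag_of xs) = h (frag_of ys)"
  shows "sym_kernel d G \<subseteq> kernel (free_Abelian_group (tuples d G)) H h"
proof -
  interpret G: group G by fact
  interpret H: comm_group H by fact
  interpret h: group_hom "free_Abelian_group (tuples d G)" H h
    using assms(3) by (simp add: group_hom_def group_hom_axioms_def)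
  note hdiff = hom_diff_free_Abelian_group[OF H.is_group assms(3)]
  have clo: "h (frag_of xs) \<in> carrier H" if "xs \<in> tuples d G" for xs
    using that by (intro h.hom_closed) simp
  have "sym_relators d G \<subseteq> kernel (free_Abelian_group (tuples d G)) H h"
  proof
    fix c assume c: "c \<in> sym_relators d G"
    then consider
        xs x y ys where "xs @ x # ys \<in> tuples d G" "y \<in> carrier G"
          "c = frag_of (xs @ (x \<otimes>\<^bsub>G\<^esub> y) # ys) - frag_of (xs @ x # ys) - frag_of (xs @ y # ys)"
      | xs ys where "xs \<in> tuples d G" "mset ys = mset xs" "c = frag_of xs - frag_of ys"
      unfolding sym_relators_def by blast
    then have "h c = \<one>\<^bsub>H\<^esub>"
    proof cases
      case 1
      then have t: "xs @ (x \<otimes>\<^bsub>G\<^esub> y) # ys \<in> tuples d G" "xs @ y # ys \<in> tuples d G"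
        by (auto simp: tuples_def)
      let ?a = "frag_of (xs @ (x \<otimes>\<^bsub>G\<^esub> y) # ys)" and ?b = "frag_of (xs @ x # ys)"
        and ?c = "frag_of (xs @ y # ys)"
      have "Poly_Mapping.keys (?a - ?b) \<subseteq> tuples d G"
        using t 1(1) by (intro order.trans[OF keys_diff]) auto
      then have "h c = (h ?a \<otimes>\<^bsub>H\<^esub> inv\<^bsub>H\<^esub> h ?b) \<otimes>\<^bsub>H\<^esub> inv\<^bsub>H\<^esub> h ?c"
        unfolding 1(3) using t 1(1) by (simp add: hdiff)
      also have "\<dots> = (h ?b \<otimes>\<^bsub>H\<^esub> h ?c \<otimes>\<^bsub>H\<^esub> inv\<^bsub>H\<^esub> h ?b) \<otimes>\<^bsub>H\<^esub> inv\<^bsub>H\<^esub> h ?c"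
        by (simp add: add[OF 1(1,2)])
      \<comment> \<open>Since \<open>H\<close> is commutative, the product of the two inverses is
        the inverse of the product of \<open>h ?b\<close> and \<open>h ?c\<close>.\<close>
      also have "\<dots> = \<one>\<^bsub>H\<^esub>"
        using clo[OF 1(1)] clo[OF t(2)] by (subst H.m_assoc) (simp_all add: H.inv_mult[symmetric])
      finally show ?thesis .
    next
      case 2
      then have ys: "ys \<in> tuples d G"
        using mset_eq_setD[OF 2(2)] mset_eq_length[OF 2(2)] by (auto simp: tuples_def)
      have "h c = h (frag_of xs) \<otimes>\<^bsub>H\<^esub> inv\<^bsub>H\<^esub> h (frag_of ys)"
        unfolding 2(3) using 2(1) ys by (simp add: hdiff)
      then show ?thesis
        using perm[OF 2(1,2)] clo[OF ys] by simp
    qed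
    then show "c \<in> kernel (free_Abelian_group (tuples d G)) H h"
      using c sym_relators_subset_carrier[OF assms(1)] unfolding kernel_def by blast
  qed
  then show ?thesis
    unfolding sym_kernel_def
    by (intro group.generate_subgroup_incl h.subgroup_kernel) simp_all
qed

text \<open>Two factorizations are chained: \<open>f\<close> extends from the basis of tuples to a
  homomorphism \<open>h\<close> on the free abelian group, and \<open>h\<close> descends to the
  quotient because it kills \<open>sym_kernel\<close>.\<close>

lemma sym_power_universal:
  assumes "group G" "comm_group H"
    and closed: "\<And>xs. xs \<in> tuples d G \<Longrightarrow> f xs \<in> carrier H"
    and add: "\<And>xs x y ys. xs @ x # ys \<in> tuples d G \<Longrightarrow> y \<in> carrier G \<Longrightarrow>
      f (xs @ (x \<otimes>\<^bsub>G\<^esub> y) # ys) = f (xs @ x # ys) \<otimes>\<^bsub>H\<^esub> f (xs @ y # ys)"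
    and perm: "\<And>xs ys. xs \<in> tuples d G \<Longrightarrow> mset ys = mset xs \<Longrightarrow> f xs = f ys"
  obtains \<phi> where "\<phi> \<in> hom (sym_power d G) H" "\<And>xs. xs \<in> tuples d G \<Longrightarrow> \<phi> (sym_prod G xs) = f xs"
proof -
  interpret G: group G by fact
  interpret H: comm_group H by fact
  have "f ` tuples d G \<subseteq> carrier H"
    using closed by blast
  from H.free_Abelian_group_universal[OF this]
  obtain h where h: "h \<in> hom (free_Abelian_group (tuples d G)) H"
    "\<And>xs. xs \<in> tuples d G \<Longrightarrow> h (frag_of xs) = f xs"
    by blast
  interpret h: group_hom "free_Abelian_group (tuples d G)" H h
    using h(1) by (simp add: group_hom_def group_hom_axioms_def)
  have "sym_kernel d G \<subseteq> kernel (free_Abelian_group (tuples d G)) H h"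
  proof (rule sym_kernel_subset_kernel[OF assms(1,2) h(1)])
    fix xs x y ys assume t: "xs @ x # ys \<in> tuples d G" "y \<in> carrier G"
    then have "xs @ (x \<otimes>\<^bsub>G\<^esub> y) # ys \<in> tuples d G" "xs @ y # ys \<in> tuples d G"
      by (auto simp: tuples_def)
    then show "h (frag_of (xs @ (x \<otimes>\<^bsub>G\<^esub> y) # ys)) =
        h (frag_of (xs @ x # ys)) \<otimes>\<^bsub>H\<^esub> h (frag_of (xs @ y # ys))"
      using add[OF t] t by (simp add: h(2))
  next
    fix xs ys :: "'a list" assume t: "xs \<in> tuples d G" "mset ys = mset xs"
    then have "ys \<in> tuples d G"
      using mset_eq_setD[OF t(2)] mset_eq_length[OF t(2)] by (auto simp: tuples_def)
    then show "h (frag_of xs) = h (frag_of ys)"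
      using perm[OF t] t(1) by (simp add: h(2))
  qed
  from h.FactGroup_universal_kernel[OF sym_kernel_normal[OF assms(1)] this]
  obtain \<phi> where \<phi>: "\<phi> \<in> hom (sym_power d G) H"
    "\<And>c. c \<in> carrier (free_Abelian_group (tuples d G)) \<Longrightarrow> \<phi> (sym_class d G c) = h c"
    unfolding sym_power_def[symmetric] sym_class_def[symmetric] by blast
  show thesis
  proof (rule that[OF \<phi>(1)])
    fix xs assume xs: "xs \<in> tuples d G"
    then have "length xs = d" by (simp add: tuples_def)
    then show "\<phi> (sym_prod G xs) = f xs"
      using \<phi>(2)[of "frag_of xs"] xs by (simp add: sym_prod_def h(2))
  qed
qed

section \<open>Functoriality of the symmetric power\<close>

lemma map_tuples:
  assumes "f \<in> hom G H" "xs \<in> tuples d G"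
  shows "map f xs \<in> tuples d H"
  using assms by (auto simp: tuples_def dest: hom_carrier)

lemma frag_extend_map_hom:
  assumes "f \<in> hom G H"
  shows "frag_extend (\<lambda>xs. frag_of (map f xs))
    \<in> hom (free_Abelian_group (tuples d G)) (free_Abelian_group (tuples d H))"
proof (rule homI)
  fix c assume "c \<in> carrier (free_Abelian_group (tuples d G))"
  then show "frag_extend (\<lambda>xs. frag_of (map f xs)) c \<in> carrier (free_Abelian_group (tuples d H))"
    using keys_frag_extend[of "\<lambda>xs. frag_of (map f xs)" c] map_tuples[OF assms]
    by fastforce
qed (simp add: frag_extend_add)

text \<open>The entrywise map followed by the quotient map kills the relators of \<open>G\<close>,
  because \<open>f\<close> is additive and \<open>map\<close> preserves equality of multisets. Hence
  the choice of representative in the union defining \<open>sym_map\<close> does not matter.\<close>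

lemma sym_class_map_eq:
  assumes "group G" "group H" "f \<in> hom G H"
    and c: "Poly_Mapping.keys c \<subseteq> tuples d G" and c': "c' \<in> sym_class d G c"
  shows "sym_class d H (frag_extend (\<lambda>xs. frag_of (map f xs)) c') =
    sym_class d H (frag_extend (\<lambda>xs. frag_of (map f xs)) c)"
proof -
  interpret H: comm_group "sym_power d H"
    using assms(2) by (rule sym_power_comm_group)
  let ?h = "sym_class d H \<circ> frag_extend (\<lambda>xs. frag_of (map f xs))"
  have h: "?h \<in> hom (free_Abelian_group (tuples d G)) (sym_power d H)"
    by (rule hom_compose[OF frag_extend_map_hom sym_class_hom]) fact+
  interpret h: group_hom "free_Abelian_group (tuples d G)" "sym_power d H" ?h
    using h by (simp add: group_hom_def group_hom_axioms_def)
  have ker: "sym_kernel d G \<subseteq> kernel (free_Abelian_group (tuples d G)) (sym_power d H) ?h"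
  proof (rule sym_kernel_subset_kernel[OF assms(1) H.comm_group_axioms h])
    fix xs x y ys assume t: "xs @ x # ys \<in> tuples d G" "y \<in> carrier G"
    then have "map f xs @ f x # map f ys \<in> tuples d H" "f y \<in> carrier H" "x \<in> carrier G"
      using map_tuples[OF assms(3) t(1)] hom_in_carrier[OF assms(3)] by (auto simp: tuples_def)
    then show "?h (frag_of (xs @ (x \<otimes>\<^bsub>G\<^esub> y) # ys)) =
        ?h (frag_of (xs @ x # ys)) \<otimes>\<^bsub>sym_power d H\<^esub> ?h (frag_of (xs @ y # ys))"
      using t by (simp add: hom_mult[OF assms(3)] sym_class_add assms(2))
  next
    fix xs ys assume "xs \<in> tuples d G" "mset ys = mset xs"
    then show "?h (frag_of xs) = ?h (frag_of ys)"
      by (simp add: sym_class_perm[OF assms(2) map_tuples[OF assms(3)]])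
  qed
  from c' obtain k where k: "k \<in> sym_kernel d G" "c' = k + c"
    unfolding sym_class_def r_coset_def by auto
  then have "k \<in> kernel (free_Abelian_group (tuples d G)) (sym_power d H) ?h"
    using ker by blast
  then have "Poly_Mapping.keys k \<subseteq> tuples d G" "?h k = \<one>\<^bsub>sym_power d H\<^esub>"
    by (simp_all add: kernel_def)
  then have "?h (k + c) = ?h c"
    using h.hom_mult[of k c] h.hom_closed[of c] c by simp
  then show ?thesis by (simp add: k(2))
qed

lemma sym_map_class:
  assumes "group G" "group H" "f \<in> hom G H" "Poly_Mapping.keys c \<subseteq> tuples d G"
  shows "sym_map d H f (sym_class d G c) = sym_class d H (frag_extend (\<lambda>xs. frag_of (map f xs)) c)"
proof -
  interpret K: normal "sym_kernel d G" "free_Abelian_group (tuples d G)"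
    using assms(1) by (rule sym_kernel_normal)
  \<comment> \<open>The coset must be nonempty: only then does a union of equal sets over it equal
    their common value.\<close>
  have "c \<in> sym_class d G c"
    unfolding sym_class_def using assms(4) by (intro K.rcos_self K.subgroup_axioms) simp
  then show ?thesis
    unfolding sym_map_def by (intro SUP_eq_const sym_class_map_eq[OF assms]) auto
qed

lemma sym_map_prod:
  assumes "group G" "group H" "f \<in> hom G H" "xs \<in> tuples d G"
  shows "sym_map d H f (sym_prod G xs) = sym_prod H (map f xs)"
proof -
  have "length xs = d" using assms(4) by (simp add: tuples_def)
  then show ?thesis
    using assms by (simp add: sym_prod_def sym_map_class)
qed

lemma sym_map_hom:
  assumes "group G" "group H" "f \<in> hom G H"
  shows "sym_map d H f \<in> hom (sym_power d G) (sym_power d H)"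
proof (rule homI)
  note hom = sym_class_hom[OF assms(1), of d] sym_class_hom[OF assms(2), of d]
    frag_extend_map_hom[OF assms(3), of d]
  fix X assume "X \<in> carrier (sym_power d G)"
  then obtain c where c: "Poly_Mapping.keys c \<subseteq> tuples d G" "X = sym_class d G c"
    by (rule sym_power_cases)
  show "sym_map d H f X \<in> carrier (sym_power d H)"
    unfolding c(2) sym_map_class[OF assms c(1)]
    using hom_in_carrier[OF hom(3), of c] c(1) by (simp add: sym_class_closed)
  fix Y assume "Y \<in> carrier (sym_power d G)"
  then obtain c' where c': "Poly_Mapping.keys c' \<subseteq> tuples d G" "Y = sym_class d G c'"
    by (rule sym_power_cases)
  have s: "Poly_Mapping.keys (c + c') \<subseteq> tuples d G"
    using c(1) c'(1) keys_add[of c c'] by blast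
  have "X \<otimes>\<^bsub>sym_power d G\<^esub> Y = sym_class d G (c + c')"
    using hom_mult[OF hom(1), of c c'] c c' by simp
  then show "sym_map d H f (X \<otimes>\<^bsub>sym_power d G\<^esub> Y) =
      sym_map d H f X \<otimes>\<^bsub>sym_power d H\<^esub> sym_map d H f Y"
    using hom_mult[OF hom(2)] hom_in_carrier[OF hom(3), of c] hom_in_carrier[OF hom(3), of c'] c c'
    by (simp add: sym_map_class[OF assms] s frag_extend_add)
qed

section \<open>Reflecting the first coordinate\<close>

lemma group_I_obj: "group (I_obj n)"
  unfolding I_obj_def using comm_group_vec by (rule comm_group.axioms(2))

lemma I_mor_hom: "A \<in> carrier_mat t s \<Longrightarrow> I_mor A \<in> hom (I_obj s) (I_obj t)"
  by (rule homI)
    (auto simp: I_obj_def I_mor_def monoid_vec_simps mult_add_distrib_mat_vec)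

text \<open>The product of first coordinates is additive in every factor and symmetric, so it
  descends to the symmetric power. The operation of \<open>integer_group\<close> is addition, and
  \<open>0 < n\<close> makes index 0 a genuine coordinate.\<close>

lemma first_coord_hom:
  assumes "0 < n"
  obtains \<phi> where "\<phi> \<in> hom (S_obj d n) integer_group"
    "\<And>vs. vs \<in> tuples d (I_obj n) \<Longrightarrow> \<phi> (sym_prod (I_obj n) vs) = (\<Prod>v\<leftarrow>vs. v $ 0)"
proof (rule sym_power_universal[OF group_I_obj abelian_integer_group,
      of d n "\<lambda>vs. \<Prod>v\<leftarrow>vs. v $ 0"])
  fix xs x y ys assume "xs @ x # ys \<in> tuples d (I_obj n)" "y \<in> carrier (I_obj n)"
  then have "(x \<otimes>\<^bsub>I_obj n\<^esub> y) $ 0 = x $ 0 + y $ 0"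
    using assms by (auto simp: I_obj_def monoid_vec_simps)
  then show "(\<Prod>v\<leftarrow>xs @ (x \<otimes>\<^bsub>I_obj n\<^esub> y) # ys. v $ 0) =
      (\<Prod>v\<leftarrow>xs @ x # ys. v $ 0) \<otimes>\<^bsub>integer_group\<^esub> (\<Prod>v\<leftarrow>xs @ y # ys. v $ 0)"
    by (simp add: algebra_simps)
next
  fix xs ys :: "int vec list" assume "mset ys = mset xs"
  then show "(\<Prod>v\<leftarrow>xs. v $ 0) = (\<Prod>v\<leftarrow>ys. v $ 0)"
    by (metis mset_map prod_mset_prod_list)
qed (use that in \<open>auto simp: S_obj_def\<close>)

section \<open>The matrix diag(-1, 1, ..., 1) and its value under D\<close>

lemma whisker_antipode:
  "whisker 0 Antipode m =
    mat (Suc m) (Suc m) (\<lambda>(i, j). if i = j then if i = 0 then - 1 else 1 else 0)"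
  by (rule eq_matI) (auto simp: whisker_def Let_def dim_diag_block_mat)

lemma whisker_antipode_involution:
  "whisker 0 Antipode m * whisker 0 Antipode m = 1\<^sub>m (Suc m)"
  unfolding whisker_antipode
  by (rule eq_matI) (auto simp: scalar_prod_def if_distrib[of "\<lambda>x. x * _"] cong: if_cong)

text \<open>The matrix is its own inverse, which provides the witness for membership in
  \<open>Units\<close>.\<close>

lemma whisker_antipode_GL: "whisker 0 Antipode m \<in> GL (Suc m)"
  unfolding GL_def Units_def ring_mat_simps
  using whisker_antipode_involution[of m]
  by (auto simp: whisker_antipode ring_mat_def intro!: bexI[of _ "whisker 0 Antipode m"])

lemma whisker_antipode_mult_vec_0:
  assumes "v \<in> carrier_vec (Suc m)"
  shows "(whisker 0 Antipode m *\<^sub>v v) $ 0 = - v $ 0"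
  unfolding whisker_antipode using assms
  by (auto simp: scalar_prod_def if_distrib[of "\<lambda>x. x * _"] cong: if_cong)

lemma whisker_antipode_mult_unit_vec:
  "whisker 0 Antipode m *\<^sub>v unit_vec (Suc m) 0 = - unit_vec (Suc m) 0"
  unfolding whisker_antipode
  by (rule eq_vecI) (auto simp: scalar_prod_def unit_vec_def if_distrib[of "\<lambda>x. x * _"] cong: if_cong)

text \<open>Here \<open>p = 2\<close> enters: for even exponent the coefficient
  \<open>(1 + (- 1) ^ d) div int p\<close> is 2 div 2 = 1, so a single copy of the power of the
  basis vector appears.\<close>

lemma D_map_antipode:
  assumes "even (p ^ l)" "p = 2"
  shows "D_map p l 0 Antipode m (unit_vec (Suc m) 0) =
    sym_prod (I_obj (Suc m)) (replicate (p ^ l) (unit_vec (Suc m) 0))"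
proof -
  interpret T: comm_group "S_obj (p ^ l) (Suc m)"
    unfolding S_obj_def by (rule sym_power_comm_group[OF group_I_obj])
  let ?a = "sym_prod (I_obj (Suc m)) (replicate (p ^ l) (unit_vec (Suc m) 0))"
  have a: "?a \<in> carrier (S_obj (p ^ l) (Suc m))"
    unfolding S_obj_def
    by (rule sym_prod_closed) (auto simp: tuples_def I_obj_def monoid_vec_simps)
  have dims: "dim_row (whisker 0 Antipode m) = Suc m" "dim_col (whisker 0 Antipode m) = Suc m"
    by (simp_all add: whisker_antipode)
  have val: "D_value p l 0 Antipode m = ?a"
    using assms T.int_pow_1[OF a] by (simp add: Let_def)
  \<comment> \<open>The factor at index 0 has exponent 1 and all others are trivial. The condition
    is oriented as \<open>0 = i\<close> to match \<open>finprod_singleton\<close>.\<close>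
  have "D_map p l 0 Antipode m (unit_vec (Suc m) 0) =
      finprod (S_obj (p ^ l) (Suc m))
        (\<lambda>i. if 0 = i then ?a else \<one>\<^bsub>S_obj (p ^ l) (Suc m)\<^esub>) {..<Suc m}"
    unfolding D_map_def dims Let_def val
    by (rule T.finprod_cong') (use a in \<open>auto simp: unit_vec_def\<close>)
  also have "\<dots> = ?a"
    using a by (subst T.finprod_singleton) auto
  finally show ?thesis .
qed

section \<open>Parity obstruction to an equivariant section\<close>

theorem mainTheorem6:
  fixes n l p d :: nat
    and E :: "int mat \<Rightarrow> (int vec list \<Rightarrow>\<^sub>0 int) set \<times> int vec \<Rightarrow> (int vec list \<Rightarrow>\<^sub>0 int) set \<times> int vec"
  assumes "n \<ge> 1" and "l \<ge> 1" and "p = 2" and "d = 2 ^ l"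
    and "is_E p l E"
  shows "\<not> GL_extension_splits n (E_obj d n) E snd (I_obj n) I_mor"
proof
  assume "GL_extension_splits n (E_obj d n) E snd (I_obj n) I_mor"
  then obtain \<sigma> where \<sigma>: "\<sigma> \<in> hom (I_obj n) (E_obj d n)"
    and equivariant: "\<And>A v. A \<in> GL n \<Longrightarrow> v \<in> carrier (I_obj n) \<Longrightarrow> \<sigma> (I_mor A v) = E A (\<sigma> v)"
    and snd_\<sigma>: "\<And>v. v \<in> carrier (I_obj n) \<Longrightarrow> snd (\<sigma> v) = v"
    unfolding GL_extension_splits_def GL_hom_def by auto
  obtain m where n: "n = Suc m" using assms(1) by (cases n) auto
  have d: "d = p ^ l" "even d" using assms(2-4) by auto
  interpret S: comm_group "S_obj d n"
    unfolding S_obj_def by (rule sym_power_comm_group[OF group_I_obj])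
  obtain \<phi> where \<phi>: "\<phi> \<in> hom (S_obj d n) integer_group"
    and \<phi>_prod: "\<And>vs. vs \<in> tuples d (I_obj n) \<Longrightarrow> \<phi> (sym_prod (I_obj n) vs) = (\<Prod>v\<leftarrow>vs. v $ 0)"
    using first_coord_hom[of n d] n by auto
  define A where "A = whisker 0 Antipode m"
  have A: "A \<in> carrier_mat n n" "A \<in> GL n" "dim_row A = n" "dim_col A = n"
    unfolding A_def n using whisker_antipode_GL by (simp_all add: whisker_antipode)
  have A_hom: "I_mor A \<in> hom (I_obj n) (I_obj n)"
    using A(1) by (rule I_mor_hom)
  have SA_hom: "S_mor d A \<in> hom (S_obj d n) (S_obj d n)"
    unfolding S_mor_def S_obj_def A(3) by (rule sym_map_hom[OF group_I_obj group_I_obj A_hom])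
  \<comment> \<open>Both sides are homomorphisms in \<open>x\<close>, so symmetric products suffice.
    There each of the \<open>d\<close> factors contributes a sign, and the signs cancel because
    \<open>d\<close> is even.\<close>
  have \<phi>_invariant: "\<phi> (S_mor d A x) = \<phi> x" if "x \<in> carrier (S_obj d n)" for x
  proof -
    have "(\<phi> \<circ> S_mor d A) (sym_prod (I_obj n) vs) = \<phi> (sym_prod (I_obj n) vs)"
      if vs: "vs \<in> tuples d (I_obj n)" for vs
    proof -
      have "(\<phi> \<circ> S_mor d A) (sym_prod (I_obj n) vs) = (\<Prod>v\<leftarrow>map (I_mor A) vs. v $ 0)"
        using \<phi>_prod[OF map_tuples[OF A_hom vs]]
        by (simp add: S_mor_def A(3) sym_map_prod[OF group_I_obj group_I_obj A_hom vs])
      \<comment> \<open>The negation is written as a factor -1 so that the next step can collect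
        these factors into a power.\<close>
      also have "\<dots> = (\<Prod>v\<leftarrow>vs. - 1 * v $ 0)"
        using vs unfolding map_map
        by (intro arg_cong[where f = prod_list] map_cong)
          (auto simp: tuples_def I_obj_def I_mor_def monoid_vec_simps A_def n
            intro!: whisker_antipode_mult_vec_0)
      also have "\<dots> = (- 1) ^ length vs * (\<Prod>v\<leftarrow>vs. v $ 0)"
        by (induction vs) auto
      also have "\<dots> = \<phi> (sym_prod (I_obj n) vs)"
        using vs d(2) \<phi>_prod[OF vs] by (simp add: tuples_def)
      finally show ?thesis .
    qed
    then have "(\<phi> \<circ> S_mor d A) x = \<phi> x"
      using sym_power_hom_eqI[OF group_I_obj group_integer_group
          hom_compose[OF SA_hom \<phi>, unfolded S_obj_def] \<phi>[unfolded S_obj_def]] that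
      by (simp add: S_obj_def)
    then show ?thesis by simp
  qed
  define e :: "int vec" where "e = unit_vec n 0"
  have e: "e \<in> carrier (I_obj n)" by (simp add: e_def I_obj_def monoid_vec_simps)
  \<comment> \<open>The relation A e = - e is stated as a vanishing sum, so that applying \<sigma>
    requires no inverse in \<open>E_obj d n\<close>.\<close>
  have Ae: "I_mor A e \<otimes>\<^bsub>I_obj n\<^esub> e = \<one>\<^bsub>I_obj n\<^esub>" "I_mor A e \<in> carrier (I_obj n)"
    by (simp_all add: I_mor_def e_def A_def n whisker_antipode_mult_unit_vec I_obj_def monoid_vec_simps)
  \<comment> \<open>Being a section fixes the second component of \<open>\<sigma> e\<close>; only
    the component \<open>x\<close> in the symmetric power is free.\<close>
  obtain x where x: "x \<in> carrier (S_obj d n)" "\<sigma> e = (x, e)"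
    using hom_in_carrier[OF \<sigma> e] snd_\<sigma>[OF e] by (auto simp: E_obj_def)
  define a where "a = sym_prod (I_obj n) (replicate d e)"
  have rep: "replicate d e \<in> tuples d (I_obj n)"
    using e by (auto simp: tuples_def)
  have a: "a \<in> carrier (S_obj d n)" "\<phi> a = 1"
    using sym_prod_closed[OF rep] \<phi>_prod[OF rep] n
    by (simp_all add: a_def S_obj_def e_def prod_list_replicate)
  have "\<sigma> (I_mor A e) = E A (x, e)"
    using equivariant[OF A(2) e] x(2) by simp
  also have "\<dots> = (S_mor d A x \<otimes>\<^bsub>S_obj d n\<^esub> a, I_mor A e)"
  proof -
    \<comment> \<open>As \<open>A\<close> is a whiskered generator, the prescribed block triangular
      formula for \<open>E\<close> applies to it directly.\<close>
    have "\<forall>x \<in> carrier (S_obj d n). \<forall>v \<in> carrier (I_obj n).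
        E A (x, v) = (S_mor d A x \<otimes>\<^bsub>S_obj d n\<^esub> D_map p l 0 Antipode m v, I_mor A v)"
      using conjunct2[OF assms(5)[unfolded is_E_def Let_def],
          THEN spec[of _ 0], THEN spec[of _ Antipode], THEN spec[of _ m]]
      unfolding A_def[symmetric] A(3,4) d(1)[symmetric] .
    moreover have "D_map p l 0 Antipode m e = a"
      unfolding a_def e_def n d(1) using d assms(3) by (intro D_map_antipode) simp_all
    ultimately show ?thesis using x(1) e by simp
  qed
  finally have "\<sigma> (I_mor A e) = (S_mor d A x \<otimes>\<^bsub>S_obj d n\<^esub> a, I_mor A e)" .
  moreover have "\<sigma> (I_mor A e) \<otimes>\<^bsub>E_obj d n\<^esub> \<sigma> e = \<one>\<^bsub>E_obj d n\<^esub>"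
    using hom_mult[OF \<sigma> Ae(2) e] Ae(1) hom_one[OF \<sigma> group_I_obj] DirProd_group[OF S.is_group group_I_obj]
    by (simp add: E_obj_def)
  \<comment> \<open>This is the first component of the equation in the direct product.\<close>
  ultimately have "S_mor d A x \<otimes>\<^bsub>S_obj d n\<^esub> a \<otimes>\<^bsub>S_obj d n\<^esub> x = \<one>\<^bsub>S_obj d n\<^esub>"
    by (simp add: E_obj_def x(2))
  then have "\<phi> (S_mor d A x \<otimes>\<^bsub>S_obj d n\<^esub> a \<otimes>\<^bsub>S_obj d n\<^esub> x) = 0"
    using hom_one[OF \<phi> S.is_group] by simp
  \<comment> \<open>The invariance of \<phi> replaces the term of \<open>S_mor d A x\<close> by
    \<open>\<phi> x\<close>, and \<open>a\<close> contributes 1. The left side is therefore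
    odd.\<close>
  then have "\<phi> x + 1 + \<phi> x = 0"
    using x(1) a hom_in_carrier[OF SA_hom x(1)] by (simp add: hom_mult[OF \<phi>] \<phi>_invariant)
  then show False by presburger
qed

end
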